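(* For any $t\in\mathbb{C}$, the following statements hold. (a) $\partial_i$ and $\delta_i$ $(1\le i\le n)$ are also derivations of the algebra $\mathcal{B}_t[\xi,z]$. (b) For any $1\le i\le n$, $$(\Phi_t)_*(\partial_i)=\partial_i,\qquad (\Phi_t)_*(\delta_i)=\delta_i .$$
   Context: Let $\xi=(\xi_1,\dots,\xi_n)$ and $z=(z_1,\dots,z_n)$ be $2n$ commuting free variables, $\partial_i=\partial/\partial z_i$, $\delta_i=\partial/\partial \xi_i$. $\mathcal{A}[\xi,z]$ is the vector space $\mathbb{C}[\xi,z]$ with the usual polynomial multiplication. For $t\in\mathbb{C}$, $\mathcal{B}_t[\xi,z]$ is the vector space $\mathbb{C}[\xi,z]$ with the product $f\ast_t g:=\mu\big(e^{-t\Omega}(f\otimes g)\big)$, where $\Omega=\sum_{i=1}^n(\partial_i\otimes\delta_i+\delta_i\otimes\partial_i)$ and $\mu(f\otimes g)=fg$ is the usual multiplication. Let $\Lambda:=\sum_{i=1}^n\delta_i\partial_i$ and $\Phi_t:=e^{t\Lambda}=\sum_{m\ge0}\frac{t^m\Lambda^m}{m!}$, an algebra isomorphism $\mathcal{B}_t[\xi,z]\to\mathcal{A}[\xi,z]$ with inverse $\Phi_{-t}$. Let $\mathcal{D}_t[\xi,z]$ (resp. $\mathcal{D}[\xi,z]$) be the Weyl algebra of $\mathcal{B}_t[\xi,z]$ (resp. $\mathcal{A}[\xi,z]$), i.e. the associative algebra of linear endomorphisms of $\mathbb{C}[\xi,z]$ generated by the $\mathbb{C}$-derivations and the multiplication operators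 of the given algebra. The induced isomorphism $(\Phi_t)_*:\mathcal{D}_t[\xi,z]\to\mathcal{D}[\xi,z]$ is $(\Phi_t)_*(\psi)=\Phi_t\circ\psi\circ\Phi_t^{-1}=\Phi_t\circ\psi\circ\Phi_{-t}$. *)

theory Defs
  imports Complex_Main "HOL-Library.Poly_Mapping" "HOL-Library.FuncSet"
begin

section \<open>Complex vector spaces with a given basis\<close>

text \<open>
  The type \<^typ>\<open>'k \<Rightarrow>\<^sub>0 complex\<close> is the complex vector space with basis \<^typ>\<open>'k\<close>.
\<close>

definition scale :: "complex \<Rightarrow> ('k \<Rightarrow>\<^sub>0 complex) \<Rightarrow> 'k \<Rightarrow>\<^sub>0 complex" where
  "scale c = Poly_Mapping.map ((*) c)"

definition lin_ext :: "('k \<Rightarrow> 'l \<Rightarrow>\<^sub>0 complex) \<Rightarrow> ('k \<Rightarrow>\<^sub>0 complex) \<Rightarrow> 'l \<Rightarrow>\<^sub>0 complex" where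
  "lin_ext b w = (\<Sum>k\<in>Poly_Mapping.keys w. scale (Poly_Mapping.lookup w k) (b k))"

text \<open>
  The exponential \<open>exp (c T)\<close> of a locally nilpotent operator \<open>T\<close>: applied to a vector,
  only finitely many terms of the series are nonzero, and \<^const>\<open>Sum_any\<close> adds these up.
  (\<^const>\<open>Sum_any\<close> is \<open>0\<close> for infinitely many nonzero terms; by the lemmas
  \<open>finite_Lambda_powers\<close> and \<open>finite_Omega_powers\<close> below this never occurs here.)
\<close>

definition exp_op ::
  "complex \<Rightarrow> (('k \<Rightarrow>\<^sub>0 complex) \<Rightarrow> 'k \<Rightarrow>\<^sub>0 complex) \<Rightarrow> ('k \<Rightarrow>\<^sub>0 complex) \<Rightarrow> 'k \<Rightarrow>\<^sub>0 complex" where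
  "exp_op c T w = Sum_any (\<lambda>m::nat. scale (c ^ m / fact m) ((T ^^ m) w))"

section \<open>Polynomials in \<open>\<xi>\<close> and \<open>z\<close>\<close>

text \<open>
  The finite type \<^typ>\<open>'n\<close> is the index set \<open>{1, \<dots>, n}\<close>. Monomials are exponent vectors; the
  product \<open>(*)\<close> of the library on \<open>'n mpoly\<close> is the usual multiplication of
  polynomials, so that \<open>'n mpoly\<close> with \<open>(*)\<close> is the algebra \<open>\<A>[\<xi>,z]\<close>.
\<close>

datatype 'n var = Xi 'n | Z 'n

type_synonym 'n monom = "'n var \<Rightarrow>\<^sub>0 nat"
type_synonym 'n mpoly = "'n monom \<Rightarrow>\<^sub>0 complex"

text \<open>
  If \<open>v\<close> does not occur in the monomial \<open>a\<close>, the (truncated) difference is irrelevant because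
  the coefficient is \<open>0\<close>.
\<close>

definition pdiff :: "'n var \<Rightarrow> 'n mpoly \<Rightarrow> 'n mpoly" where
  "pdiff v = lin_ext (\<lambda>a. Poly_Mapping.single (a - Poly_Mapping.single v 1)
                            (of_nat (Poly_Mapping.lookup a v)))"

definition dz :: "'n \<Rightarrow> 'n mpoly \<Rightarrow> 'n mpoly" where
  "dz i = pdiff (Z i)"

definition dxi :: "'n \<Rightarrow> 'n mpoly \<Rightarrow> 'n mpoly" where
  "dxi i = pdiff (Xi i)"

section \<open>The tensor square and the product of \<open>\<B>\<^sub>t[\<xi>,z]\<close>\<close>

text \<open>
  The tensor square of a vector space with basis \<open>B\<close> is the vector space with basis \<open>B \<times> B\<close>;
  the pair \<open>(a, b)\<close> stands for the pure tensor of the basis vectors \<open>a\<close> and \<open>b\<close>.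
\<close>

type_synonym 'n tensor2 = "'n monom \<times> 'n monom \<Rightarrow>\<^sub>0 complex"

definition tensor :: "'n mpoly \<Rightarrow> 'n mpoly \<Rightarrow> 'n tensor2" where
  "tensor f g = lin_ext (\<lambda>a. lin_ext (\<lambda>b. Poly_Mapping.single (a, b) 1) g) f"

definition tensor_map ::
  "('n mpoly \<Rightarrow> 'n mpoly) \<Rightarrow> ('n mpoly \<Rightarrow> 'n mpoly) \<Rightarrow> 'n tensor2 \<Rightarrow> 'n tensor2" where
  "tensor_map D E =
     lin_ext (\<lambda>(a, b). tensor (D (Poly_Mapping.single a 1)) (E (Poly_Mapping.single b 1)))"

definition mu :: "'n tensor2 \<Rightarrow> 'n mpoly" where
  "mu = lin_ext (\<lambda>(a, b). Poly_Mapping.single a 1 * Poly_Mapping.single b 1)"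

definition Omega :: "'n::finite tensor2 \<Rightarrow> 'n tensor2" where
  "Omega w = (\<Sum>i\<in>UNIV. tensor_map (dz i) (dxi i) w + tensor_map (dxi i) (dz i) w)"

definition star :: "complex \<Rightarrow> 'n::finite mpoly \<Rightarrow> 'n mpoly \<Rightarrow> 'n mpoly" where
  "star t f g = mu (exp_op (- t) Omega (tensor f g))"

definition Lambda :: "'n::finite mpoly \<Rightarrow> 'n mpoly" where
  "Lambda f = (\<Sum>i\<in>UNIV. dxi i (dz i f))"

definition Phi :: "complex \<Rightarrow> 'n::finite mpoly \<Rightarrow> 'n mpoly" where
  "Phi t = exp_op t Lambda"

section \<open>Derivations and Weyl algebras\<close>

text \<open>
  An algebra structure on \<^typ>\<open>'n mpoly\<close> is given by its multiplication \<open>m\<close>.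
\<close>

definition derivation ::
  "('n mpoly \<Rightarrow> 'n mpoly \<Rightarrow> 'n mpoly) \<Rightarrow> ('n mpoly \<Rightarrow> 'n mpoly) \<Rightarrow> bool" where
  "derivation m D \<longleftrightarrow> Vector_Spaces.linear scale scale D \<and>
     (\<forall>f g. D (m f g) = m (D f) g + m f (D g))"

inductive_set weyl_algebra ::
  "('n mpoly \<Rightarrow> 'n mpoly \<Rightarrow> 'n mpoly) \<Rightarrow> ('n mpoly \<Rightarrow> 'n mpoly) set"
  for m :: "'n mpoly \<Rightarrow> 'n mpoly \<Rightarrow> 'n mpoly" where
  deriv: "derivation m D \<Longrightarrow> D \<in> weyl_algebra m"
| mult: "m f \<in> weyl_algebra m"
| ident: "id \<in> weyl_algebra m"
| add: "\<phi> \<in> weyl_algebra m \<Longrightarrow> \<psi> \<in> weyl_algebra m \<Longrightarrow> (\<lambda>f. \<phi> f + \<psi> f) \<in> weyl_algebra m"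
| scale: "\<phi> \<in> weyl_algebra m \<Longrightarrow> (\<lambda>f. scale c (\<phi> f)) \<in> weyl_algebra m"
| comp: "\<phi> \<in> weyl_algebra m \<Longrightarrow> \<psi> \<in> weyl_algebra m \<Longrightarrow> \<phi> \<circ> \<psi> \<in> weyl_algebra m"

text \<open>
  The map \<open>(\<Phi>\<^sub>t)\<^sub>*\<close> has domain \<open>\<D>\<^sub>t[\<xi>,z]\<close> and is \<^const>\<open>undefined\<close> outside of it.
\<close>

definition Phi_push :: "complex \<Rightarrow> ('n::finite mpoly \<Rightarrow> 'n mpoly) \<Rightarrow> 'n mpoly \<Rightarrow> 'n mpoly" where
  "Phi_push t = (\<lambda>\<psi>\<in>weyl_algebra (star t). Phi t \<circ> \<psi> \<circ> inv (Phi t))"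

section \<open>Basic properties\<close>

lemma lookup_scale [simp]:
  "Poly_Mapping.lookup (scale c w) k = c * Poly_Mapping.lookup w k"
  by (simp add: scale_def Poly_Mapping.map.rep_eq when_def)

lemma vector_space_scale: "vector_space (scale :: complex \<Rightarrow> ('k \<Rightarrow>\<^sub>0 complex) \<Rightarrow> _)"
  by unfold_locales (auto intro!: poly_mapping_eqI simp: lookup_add algebra_simps)

interpretation scale: vector_space scale
  by (rule vector_space_scale)

lemma lin_ext_superset:
  assumes "finite K" "Poly_Mapping.keys w \<subseteq> K"
  shows "lin_ext b w = (\<Sum>k\<in>K. scale (Poly_Mapping.lookup w k) (b k))"
  unfolding lin_ext_def
  by (rule sum.mono_neutral_left) (use assms in \<open>auto simp: in_keys_iff\<close>)

lemma linear_lin_ext: "Vector_Spaces.linear scale scale (lin_ext b)"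
proof -
  have 1: "lin_ext b (v + w) = lin_ext b v + lin_ext b w" for v w
  proof -
    let ?K = "Poly_Mapping.keys v \<union> Poly_Mapping.keys w"
    have "Poly_Mapping.keys (v + w) \<subseteq> ?K" by (rule Poly_Mapping.keys_add)
    then show ?thesis
      by (simp add: lin_ext_superset[of ?K] lookup_add scale.scale_left_distrib sum.distrib)
  qed
  have 2: "lin_ext b (scale c w) = scale c (lin_ext b w)" for c w
  proof -
    have "Poly_Mapping.keys (scale c w) \<subseteq> Poly_Mapping.keys w"
      by (auto simp: in_keys_iff)
    then show ?thesis
      by (simp add: lin_ext_superset[of "Poly_Mapping.keys w"] scale.scale_sum_right)
  qed
  show ?thesis
    by (simp add: Vector_Spaces.linear_iff vector_space_scale 1 2)
qed

lemma lin_ext_single [simp]: "lin_ext b (Poly_Mapping.single k c) = scale c (b k)"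
  by (cases "c = 0") (simp_all add: lin_ext_def)

lemma linear_eq_lin_ext:
  assumes "Vector_Spaces.linear scale scale T"
  shows "T w = lin_ext (\<lambda>k. T (Poly_Mapping.single k 1)) w"
proof -
  interpret Vector_Spaces.linear scale scale T by fact
  have "w = (\<Sum>k\<in>Poly_Mapping.keys w. scale (Poly_Mapping.lookup w k) (Poly_Mapping.single k 1))"
    by (rule poly_mapping_eqI)
       (auto simp: lookup_sum lookup_single when_def in_keys_iff if_distrib cong: if_cong)
  then have "T w = T (\<Sum>k\<in>Poly_Mapping.keys w. scale (Poly_Mapping.lookup w k) (Poly_Mapping.single k 1))"
    by simp
  then show ?thesis by (simp add: sum scale lin_ext_def)
qed

lemma linear_eqI:
  assumes "Vector_Spaces.linear scale scale S" "Vector_Spaces.linear scale scale T"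
    and "\<And>k. S (Poly_Mapping.single k 1) = T (Poly_Mapping.single k 1)"
  shows "S w = T w"
  by (simp only: linear_eq_lin_ext[OF assms(1), of w] linear_eq_lin_ext[OF assms(2), of w] assms(3))

lemma linear_comp:
  assumes "Vector_Spaces.linear scale scale S" "Vector_Spaces.linear scale scale T"
  shows "Vector_Spaces.linear scale scale (\<lambda>w. S (T w))"
  using assms by (simp add: Vector_Spaces.linear_iff)

lemma linear_tensor_left: "Vector_Spaces.linear scale scale (\<lambda>f. tensor f g)"
  unfolding tensor_def by (rule linear_lin_ext)

lemma linear_lin_ext_fun:
  assumes "\<And>k. Vector_Spaces.linear scale scale (\<lambda>g. b g k)"
  shows "Vector_Spaces.linear scale scale (\<lambda>g. lin_ext (b g) f)"
  using assms
  by (simp add: Vector_Spaces.linear_iff lin_ext_def scale.scale_right_distrib sum.distrib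
      scale.scale_sum_right mult.commute)

lemma linear_tensor_right: "Vector_Spaces.linear scale scale (tensor f)"
  unfolding tensor_def by (intro linear_lin_ext_fun linear_lin_ext)

lemma tensor_single [simp]:
  "tensor (Poly_Mapping.single a 1) (Poly_Mapping.single b 1) = Poly_Mapping.single (a, b) 1"
  by (simp add: tensor_def)

lemma bilinear_eqI:
  fixes S T :: "('k \<Rightarrow>\<^sub>0 complex) \<Rightarrow> ('l \<Rightarrow>\<^sub>0 complex) \<Rightarrow> ('m \<Rightarrow>\<^sub>0 complex)"
  assumes "\<And>g. Vector_Spaces.linear scale scale (\<lambda>f. S f g)"
    and "\<And>f. Vector_Spaces.linear scale scale (S f)"
    and "\<And>g. Vector_Spaces.linear scale scale (\<lambda>f. T f g)"
    and "\<And>f. Vector_Spaces.linear scale scale (T f)"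
    and "\<And>a b. S (Poly_Mapping.single a 1) (Poly_Mapping.single b 1)
             = T (Poly_Mapping.single a 1) (Poly_Mapping.single b 1)"
  shows "S f g = T f g"
proof (rule linear_eqI[OF assms(1) assms(3)])
  fix a show "S (Poly_Mapping.single a 1) g = T (Poly_Mapping.single a 1) g"
    by (rule linear_eqI[OF assms(2) assms(4) assms(5)])
qed

lemma tensor_map_tensor:
  assumes D: "Vector_Spaces.linear scale scale D" and E: "Vector_Spaces.linear scale scale E"
  shows "tensor_map D E (tensor f g) = tensor (D f) (E g)"
proof (rule bilinear_eqI[where S = "\<lambda>f g. tensor_map D E (tensor f g)" and T = "\<lambda>f g. tensor (D f) (E g)"])
  have L: "Vector_Spaces.linear scale scale (tensor_map D E)"
    unfolding tensor_map_def by (rule linear_lin_ext)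
  show "Vector_Spaces.linear scale scale (\<lambda>f. tensor_map D E (tensor f g))" for g
    by (rule linear_comp[OF L linear_tensor_left])
  show "Vector_Spaces.linear scale scale (\<lambda>g. tensor_map D E (tensor f g))" for f
    by (rule linear_comp[OF L linear_tensor_right])
  show "Vector_Spaces.linear scale scale (\<lambda>f. tensor (D f) (E g))" for g
    by (rule linear_comp[OF linear_tensor_left D])
  show "Vector_Spaces.linear scale scale (\<lambda>g. tensor (D f) (E g))" for f
    by (rule linear_comp[OF linear_tensor_right E])
qed (simp add: tensor_map_def)

lemma scale_eq_mult:
  "scale c (f :: 'k::monoid_add \<Rightarrow>\<^sub>0 complex) = Poly_Mapping.single 0 c * f"
  by (simp add: scale_def mult_map_scale_conv_mult)

lemma linear_mult_right: "Vector_Spaces.linear scale scale ((*) (f :: 'n mpoly))"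
  by (simp add: Vector_Spaces.linear_iff vector_space_scale distrib_left scale_eq_mult mult.left_commute)

lemma linear_mult_left: "Vector_Spaces.linear scale scale (\<lambda>f :: 'n mpoly. f * g)"
  by (simp add: Vector_Spaces.linear_iff vector_space_scale distrib_right scale_eq_mult mult.assoc)

lemma mu_tensor: "mu (tensor f g) = f * g"
proof (rule bilinear_eqI[where S = "\<lambda>f g. mu (tensor f g)" and T = "(*)"])
  have L: "Vector_Spaces.linear scale scale mu"
    unfolding mu_def by (rule linear_lin_ext)
  show "Vector_Spaces.linear scale scale (\<lambda>f. mu (tensor f g))" for g :: "'a mpoly"
    by (rule linear_comp[OF L linear_tensor_left])
  show "Vector_Spaces.linear scale scale (\<lambda>g. mu (tensor f g))" for f :: "'a mpoly"
    by (rule linear_comp[OF L linear_tensor_right])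
qed (simp_all add: linear_mult_left linear_mult_right mu_def)

lemma linear_pdiff: "Vector_Spaces.linear scale scale (pdiff v)"
  unfolding pdiff_def by (rule linear_lin_ext)

lemma linear_plus:
  assumes "Vector_Spaces.linear scale scale S" "Vector_Spaces.linear scale scale T"
  shows "Vector_Spaces.linear scale scale (\<lambda>w. S w + T w)"
  using assms by (simp add: Vector_Spaces.linear_iff scale.scale_right_distrib algebra_simps)

lemma scale_single [simp]:
  "scale c (Poly_Mapping.single k d) = Poly_Mapping.single k (c * d)"
  by (rule poly_mapping_eqI) (simp add: lookup_single when_def)

lemma pdiff_single: "pdiff v (Poly_Mapping.single a c) =
    Poly_Mapping.single (a - Poly_Mapping.single v 1) (c * of_nat (Poly_Mapping.lookup a v))"
  by (simp add: pdiff_def)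

lemma derivation_pdiff: "derivation (*) (pdiff v)"
proof -
  have monom: "(a + b) - Poly_Mapping.single v 1 = (a - Poly_Mapping.single v 1) + b"
    if "Poly_Mapping.lookup a v \<noteq> 0" for a b :: "'a monom"
    by (rule poly_mapping_eqI)
       (use that in \<open>auto simp: lookup_add lookup_minus lookup_single when_def\<close>)
  have "pdiff v (f * g) = pdiff v f * g + f * pdiff v g" for f g
  proof (rule bilinear_eqI[where S = "\<lambda>f g. pdiff v (f * g)" and T = "\<lambda>f g. pdiff v f * g + f * pdiff v g"])
    fix a b :: "'a monom"
    show "pdiff v (Poly_Mapping.single a 1 * Poly_Mapping.single b 1) =
        pdiff v (Poly_Mapping.single a 1) * Poly_Mapping.single b 1 +
        Poly_Mapping.single a 1 * pdiff v (Poly_Mapping.single b 1)"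
      using monom[of a b] monom[of b a]
      by (cases "Poly_Mapping.lookup a v = 0"; cases "Poly_Mapping.lookup b v = 0")
         (simp_all add: pdiff_single mult_single lookup_add add.commute[of _ a] single_add[symmetric])
  qed (intro linear_plus linear_comp[OF linear_pdiff] linear_mult_right linear_mult_left
        linear_comp[OF linear_mult_right linear_pdiff] linear_comp[OF linear_mult_left linear_pdiff])+
  then show ?thesis by (simp add: derivation_def linear_pdiff)
qed

section \<open>Local nilpotency\<close>

lemma finite_powers:
  fixes d :: "'k \<Rightarrow> nat" and T :: "('k \<Rightarrow>\<^sub>0 complex) \<Rightarrow> 'k \<Rightarrow>\<^sub>0 complex"
  assumes step: "\<And>w k. k \<in> Poly_Mapping.keys (T w) \<Longrightarrow> \<exists>l\<in>Poly_Mapping.keys w. d k < d l"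
  shows "finite {m. (T ^^ m) w \<noteq> 0}"
proof -
  have *: "\<exists>l\<in>Poly_Mapping.keys w. d k + m \<le> d l" if "k \<in> Poly_Mapping.keys ((T ^^ m) w)" for k m
    using that
  proof (induction m arbitrary: k)
    case (Suc m)
    then obtain j where "j \<in> Poly_Mapping.keys ((T ^^ m) w)" "d k < d j"
      using step[of k "(T ^^ m) w"] by auto
    
    moreover from this Suc.IH[of j] obtain l where "l \<in> Poly_Mapping.keys w" "d j + m \<le> d l" by blast
    ultimately show ?case by (intro bexI[of _ l]) simp_all
  qed auto
  have "{m. (T ^^ m) w \<noteq> 0} \<subseteq> (\<Union>l\<in>Poly_Mapping.keys w. {..d l})"
  proof safe
    fix m assume "(T ^^ m) w \<noteq> 0"
    then obtain k where "k \<in> Poly_Mapping.keys ((T ^^ m) w)" by (auto simp flip: keys_eq_empty)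
    from *[OF this] show "m \<in> (\<Union>l\<in>Poly_Mapping.keys w. {..d l})" by fastforce
  qed
  then show ?thesis by (rule finite_subset) simp
qed

lemma keys_scale: "Poly_Mapping.keys (scale c w) \<subseteq> Poly_Mapping.keys w"
  by (auto simp: in_keys_iff)

lemma keys_sumE:
  assumes "k \<in> Poly_Mapping.keys (sum b I)"
  obtains i where "i \<in> I" "k \<in> Poly_Mapping.keys (b i)"
  using subsetD[OF Poly_Mapping.keys_sum assms] by auto

lemma keys_lin_ext:
  assumes "k \<in> Poly_Mapping.keys (lin_ext b w)"
  shows "\<exists>l\<in>Poly_Mapping.keys w. k \<in> Poly_Mapping.keys (b l)"
  using assms unfolding lin_ext_def by (auto elim!: keys_sumE dest: subsetD[OF keys_scale])

instance var :: (finite) finite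
proof
  have "(UNIV :: 'a var set) = Xi ` UNIV \<union> Z ` UNIV"
    by (metis UNIV_I UNIV_eq_I Un_iff imageI var.exhaust)
  then show "finite (UNIV :: 'a var set)" by (metis finite finite_Un finite_imageI)
qed

definition mdeg :: "'n::finite monom \<Rightarrow> nat" where
  "mdeg a = (\<Sum>v\<in>UNIV. Poly_Mapping.lookup a v)"

lemma keys_pdiff:
  assumes "k \<in> Poly_Mapping.keys (pdiff v f)"
  shows "\<exists>l\<in>Poly_Mapping.keys f. mdeg k < mdeg l"
proof -
  obtain l where l: "l \<in> Poly_Mapping.keys f" "k = l - Poly_Mapping.single v 1"
      "Poly_Mapping.lookup l v \<noteq> 0"
    using keys_lin_ext[OF assms[unfolded pdiff_def]] by (auto split: if_splits)
  have "mdeg k < mdeg l"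
    unfolding mdeg_def
    by (rule sum_strict_mono_ex1) (use l in \<open>auto simp: lookup_minus lookup_single when_def\<close>)
  with l show ?thesis by blast
qed

lemma keys_tensor: "Poly_Mapping.keys (tensor f g) \<subseteq> Poly_Mapping.keys f \<times> Poly_Mapping.keys g"
  unfolding tensor_def by (fastforce dest!: keys_lin_ext split: if_splits)

lemma finite_Lambda_powers: "finite {m. (Lambda ^^ m) f \<noteq> 0}"
proof (rule finite_powers[where d = mdeg])
  fix k :: "'a monom" and w
  assume "k \<in> Poly_Mapping.keys (Lambda w)"
  then obtain i where "k \<in> Poly_Mapping.keys (pdiff (Xi i) (pdiff (Z i) w))"
    unfolding Lambda_def dxi_def dz_def by (rule keys_sumE)
  then show "\<exists>l\<in>Poly_Mapping.keys w. mdeg k < mdeg l"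
    by (meson keys_pdiff less_trans)
qed

lemma finite_Omega_powers: "finite {m. (Omega ^^ m) w \<noteq> 0}"
proof (rule finite_powers[where d = "\<lambda>(a, b). mdeg a + mdeg b"])
  fix k :: "'a monom \<times> 'a monom" and w
  have *: "\<exists>l\<in>Poly_Mapping.keys w. (case k of (a, b) \<Rightarrow> mdeg a + mdeg b) < (case l of (a, b) \<Rightarrow> mdeg a + mdeg b)"
    if k: "k \<in> Poly_Mapping.keys (tensor_map (pdiff u) (pdiff v) w)" for u v
  proof -
    obtain a b where ab: "(a, b) \<in> Poly_Mapping.keys w"
        "k \<in> Poly_Mapping.keys (tensor (pdiff u (Poly_Mapping.single a 1)) (pdiff v (Poly_Mapping.single b 1)))"
      using keys_lin_ext[OF k[unfolded tensor_map_def]] by auto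
    then have "fst k \<in> Poly_Mapping.keys (pdiff u (Poly_Mapping.single a 1))"
        "snd k \<in> Poly_Mapping.keys (pdiff v (Poly_Mapping.single b 1))"
      using subsetD[OF keys_tensor ab(2)] by auto
    from this[THEN keys_pdiff] have "mdeg (fst k) < mdeg a" "mdeg (snd k) < mdeg b"
      by simp_all
    with ab(1) show ?thesis
      by (intro bexI[of _ "(a, b)"]) (simp_all add: case_prod_beta)
  qed
  assume "k \<in> Poly_Mapping.keys (Omega w)"
  then obtain i where "k \<in> Poly_Mapping.keys (tensor_map (dz i) (dxi i) w + tensor_map (dxi i) (dz i) w)"
    unfolding Omega_def by (rule keys_sumE)
  then have "k \<in> Poly_Mapping.keys (tensor_map (dz i) (dxi i) w) \<or> k \<in> Poly_Mapping.keys (tensor_map (dxi i) (dz i) w)"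
    by (simp add: in_keys_iff lookup_add) auto
  then show "\<exists>l\<in>Poly_Mapping.keys w. (case k of (a, b) \<Rightarrow> mdeg a + mdeg b) < (case l of (a, b) \<Rightarrow> mdeg a + mdeg b)"
    unfolding dz_def dxi_def by (elim disjE) (rule *, assumption)+
qed

end

theory Submission
  imports Defs
begin

text \<open>
  The operators \<open>\<partial>\<^sub>i\<close> and \<open>\<delta>\<^sub>i\<close> are partial derivatives, so they all commute with one another.
  Everything follows from this and from one principle (\<open>linear_exp_op_commute\<close>): a linear map that
  commutes with a locally nilpotent operator \<open>T\<close> commutes with \<open>exp (c T)\<close>, because on each vector
  the exponential is a finite sum of multiples of powers of \<open>T\<close>.

  For (a), the Leibniz rule for the usual product says that \<open>D \<circ> \<mu> = \<mu> \<circ> (D \<otimes> 1 + 1 \<otimes> D)\<close>.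
  If \<open>D\<close> commutes with the partial derivatives, then the operator \<open>D \<otimes> 1 + 1 \<otimes> D\<close> commutes with
  \<open>\<Omega>\<close>, hence with \<open>exp (- t \<Omega>)\<close>, and \<open>D\<close> can be moved past
  \<open>\<mu> \<circ> exp (- t \<Omega>)\<close>: this is the Leibniz rule for the product of \<open>\<B>\<^sub>t[\<xi>,z]\<close>.

  For (b), such a \<open>D\<close> also commutes with \<open>\<Lambda>\<close>, hence with \<open>\<Phi>\<^sub>t\<close>. By (a) it lies in the domain of
  \<open>(\<Phi>\<^sub>t)\<^sub>*\<close>, and \<open>\<Phi>\<^sub>t \<circ> D \<circ> \<Phi>\<^sub>t\<^sup>-\<^sup>1 = D \<circ> \<Phi>\<^sub>t \<circ> \<Phi>\<^sub>t\<^sup>-\<^sup>1 = D\<close>. Here \<open>\<Phi>\<^sub>t\<close> is bijective with inverse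
  \<open>\<Phi>\<^sub>-\<^sub>t\<close> by the addition law of the exponential (\<open>exp_op_exp_op\<close>).
\<close>

section \<open>Exponentials of locally nilpotent operators\<close>

lemma linear_id_map: "Vector_Spaces.linear scale scale (\<lambda>w :: 'k \<Rightarrow>\<^sub>0 complex. w)"
  by (simp add: Vector_Spaces.linear_iff vector_space_scale)

lemma linear_funpow:
  fixes T :: "('k \<Rightarrow>\<^sub>0 complex) \<Rightarrow> 'k \<Rightarrow>\<^sub>0 complex"
  assumes "Vector_Spaces.linear scale scale T"
  shows "Vector_Spaces.linear scale scale (T ^^ m)"
proof (induction m)
  case (Suc m)
  show ?case using linear_comp[OF assms Suc] by (simp add: comp_def)
qed (simp add: linear_id_map id_def)

lemma exp_op_eq_sum:
  assumes "\<And>m. N \<le> m \<Longrightarrow> (T ^^ m) w = 0"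
  shows "exp_op c T w = (\<Sum>m<N. scale (c ^ m / fact m) ((T ^^ m) w))"
  unfolding exp_op_def
  by (rule Sum_any.expand_superset) (use assms in \<open>auto simp: not_less[symmetric]\<close>)

lemma funpow_eventually_zero:
  assumes "finite {m. (T ^^ m) w \<noteq> 0}"
  obtains N where "\<And>m. N \<le> m \<Longrightarrow> (T ^^ m) w = 0"
proof -
  obtain n where "\<forall>m\<in>{m. (T ^^ m) w \<noteq> 0}. m < n"
    using assms finite_nat_set_iff_bounded by blast
  then show thesis using that[of n] by fastforce
qed

lemma exp_op_add:
  assumes T: "Vector_Spaces.linear scale scale T"
    and fin: "finite {m. (T ^^ m) v \<noteq> 0}" "finite {m. (T ^^ m) w \<noteq> 0}"
  shows "exp_op c T (v + w) = exp_op c T v + exp_op c T w"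
proof -
  obtain M N where M: "\<And>m. M \<le> m \<Longrightarrow> (T ^^ m) v = 0" and N: "\<And>m. N \<le> m \<Longrightarrow> (T ^^ m) w = 0"
    using funpow_eventually_zero[OF fin(1)] funpow_eventually_zero[OF fin(2)] by metis
  have add: "(T ^^ m) (v + w) = (T ^^ m) v + (T ^^ m) w" for m
    using linear_funpow[OF T, of m] by (simp add: Vector_Spaces.linear_iff)
  show ?thesis
    by (simp add: exp_op_eq_sum[of "max M N"] M N add scale.scale_right_distrib sum.distrib)
qed

lemma linear_exp_op_commute:
  assumes P: "Vector_Spaces.linear scale scale P"
    and comm: "\<And>v. P (T v) = T (P v)"
    and fin: "finite {m. (T ^^ m) w \<noteq> 0}"
  shows "P (exp_op c T w) = exp_op c T (P w)"
proof -
  interpret P: Vector_Spaces.linear scale scale P by (rule P)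
  obtain N where N: "\<And>m. N \<le> m \<Longrightarrow> (T ^^ m) w = 0"
    using funpow_eventually_zero[OF fin] by blast
  have pow: "(T ^^ m) (P w) = P ((T ^^ m) w)" for m
    by (induction m) (simp_all add: comm)
  show ?thesis
    by (simp add: exp_op_eq_sum[of N] N pow P.zero P.sum P.scale)
qed

text \<open>
  This is the Cauchy product of two exponential series: the coefficient of \<open>T\<^sup>n\<close> on the left is
  \<open>\<Sum>\<^sub>i c\<^sup>i d\<^sup>n\<^sup>-\<^sup>i / (i! (n - i)!) = (c + d)\<^sup>n / n!\<close>, by the binomial theorem. Nilpotency makes the
  summation range irrelevant, so that the square \<open>{..<N} \<times> {..<N}\<close> may be cut down to the
  triangle \<open>i + j < N\<close>.
\<close>

lemma exp_op_exp_op: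
  assumes T: "Vector_Spaces.linear scale scale T"
    and fin: "finite {m. (T ^^ m) w \<noteq> 0}"
  shows "exp_op c T (exp_op d T w) = exp_op (c + d) T w"
proof -
  obtain N where N: "\<And>m. N \<le> m \<Longrightarrow> (T ^^ m) w = 0"
    using funpow_eventually_zero[OF fin] by blast
  define g where
    "g i j = scale (c ^ i / fact i * (d ^ j / fact j)) ((T ^^ (i + j)) w)" for i j
  have pow: "(T ^^ i) (exp_op d T w) = (\<Sum>j<N. scale (d ^ j / fact j) ((T ^^ (i + j)) w))" for i
  proof -
    interpret Ti: Vector_Spaces.linear scale scale "T ^^ i" by (rule linear_funpow[OF T])
    show ?thesis
      by (simp add: exp_op_eq_sum[of N] N Ti.sum Ti.scale funpow_add)
  qed
  have coeff: "(\<Sum>i\<le>n. c ^ i / fact i * (d ^ (n - i) / fact (n - i))) = (c + d) ^ n / fact n" for n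
    by (simp add: binomial_ring sum_divide_distrib binomial_fact field_simps)
  have "exp_op c T (exp_op d T w) = (\<Sum>i<N. \<Sum>j<N. g i j)"
    by (subst exp_op_eq_sum[of N])
       (simp_all add: pow N g_def scale.scale_sum_right)
  also have "\<dots> = (\<Sum>(i, j)\<in>{..<N} \<times> {..<N}. g i j)"
    by (simp add: sum.cartesian_product)
  also have "\<dots> = (\<Sum>(i, j)\<in>{(i, j). i + j < N}. g i j)"
    by (rule sum.mono_neutral_right) (auto simp: g_def intro!: N)
  also have "\<dots> = (\<Sum>n<N. \<Sum>i\<le>n. g i (n - i))"
    by (rule sum.triangle_reindex)
  also have "\<dots> = (\<Sum>n<N. scale ((c + d) ^ n / fact n) ((T ^^ n) w))"
    by (intro sum.cong refl) (simp add: g_def flip: coeff scale.scale_sum_left)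
  also have "\<dots> = exp_op (c + d) T w"
    by (simp add: exp_op_eq_sum[of N] N)
  finally show ?thesis .
qed

lemma exp_op_0: "exp_op 0 T w = w"
proof -
  have "{m. scale (0 ^ m / fact m) ((T ^^ m) w) \<noteq> 0} \<subseteq> {0}"
    by (auto intro: ccontr)
  then show ?thesis
    unfolding exp_op_def by (subst Sum_any.expand_superset[of "{0}"]) auto
qed

section \<open>Operators commuting with the partial derivatives\<close>

lemma pdiff_commute: "pdiff u (pdiff v f) = pdiff v (pdiff u f)"
proof (rule linear_eqI[where S = "\<lambda>f. pdiff u (pdiff v f)" and T = "\<lambda>f. pdiff v (pdiff u f)"])
  fix a :: "'a monom"
  show "pdiff u (pdiff v (Poly_Mapping.single a 1)) = pdiff v (pdiff u (Poly_Mapping.single a 1))"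
    by (cases "u = v")
       (simp_all add: pdiff_single diff_right_commute lookup_minus lookup_single_not_eq mult.commute)
qed (rule linear_comp[OF linear_pdiff linear_pdiff])+

lemma linear_sum_map:
  assumes "\<And>i. i \<in> I \<Longrightarrow> Vector_Spaces.linear scale scale (T i)"
  shows "Vector_Spaces.linear scale scale
           (\<lambda>w :: 'k \<Rightarrow>\<^sub>0 complex. \<Sum>i\<in>I. T i w :: 'l \<Rightarrow>\<^sub>0 complex)"
  using assms
  by (simp add: Vector_Spaces.linear_iff vector_space_scale sum.distrib scale.scale_sum_right)

lemma linear_tensor_map: "Vector_Spaces.linear scale scale (tensor_map D E)"
  unfolding tensor_map_def by (rule linear_lin_ext)

lemma linear_mu: "Vector_Spaces.linear scale scale mu"
  unfolding mu_def by (rule linear_lin_ext)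

lemma linear_Omega: "Vector_Spaces.linear scale scale Omega"
  unfolding Omega_def [abs_def]
  by (intro linear_sum_map linear_plus linear_tensor_map)

lemma linear_Lambda: "Vector_Spaces.linear scale scale Lambda"
  unfolding Lambda_def [abs_def] dxi_def dz_def
  by (intro linear_sum_map linear_comp[OF linear_pdiff linear_pdiff])

lemma tensor_map_commute:
  assumes lin: "Vector_Spaces.linear scale scale D" "Vector_Spaces.linear scale scale E"
      "Vector_Spaces.linear scale scale D'" "Vector_Spaces.linear scale scale E'"
    and comm: "\<And>f. D (D' f) = D' (D f)" "\<And>f. E (E' f) = E' (E f)"
  shows "tensor_map D E (tensor_map D' E' w) = tensor_map D' E' (tensor_map D E w)"
proof (rule linear_eqI[where S = "\<lambda>w. tensor_map D E (tensor_map D' E' w)"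
        and T = "\<lambda>w. tensor_map D' E' (tensor_map D E w)"])
  fix k :: "'a monom \<times> 'a monom"
  obtain a b where k: "Poly_Mapping.single k 1
      = tensor (Poly_Mapping.single a 1) (Poly_Mapping.single b 1)"
    by (cases k) simp
  show "tensor_map D E (tensor_map D' E' (Poly_Mapping.single k 1))
      = tensor_map D' E' (tensor_map D E (Poly_Mapping.single k 1))"
    unfolding k by (simp only: tensor_map_tensor lin comm)
qed (rule linear_comp[OF linear_tensor_map linear_tensor_map])+

definition leibniz :: "('n mpoly \<Rightarrow> 'n mpoly) \<Rightarrow> 'n tensor2 \<Rightarrow> 'n tensor2" where
  "leibniz D w = tensor_map D (\<lambda>f. f) w + tensor_map (\<lambda>f. f) D w"

lemma linear_leibniz: "Vector_Spaces.linear scale scale (leibniz D)"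
  unfolding leibniz_def [abs_def] by (intro linear_plus linear_tensor_map)

lemma leibniz_tensor:
  assumes "Vector_Spaces.linear scale scale D"
  shows "leibniz D (tensor f g) = tensor (D f) g + tensor f (D g)"
  by (simp add: leibniz_def tensor_map_tensor assms linear_id_map)

text \<open>
  By bilinearity this needs to be checked on pure tensors only, where it is the Leibniz rule.
\<close>

lemma derivation_mu:
  assumes "derivation (*) D"
  shows "D (mu w) = mu (leibniz D w)"
proof (rule linear_eqI[where S = "\<lambda>w. D (mu w)" and T = "\<lambda>w. mu (leibniz D w)"])
  have D: "Vector_Spaces.linear scale scale D" using assms by (simp add: derivation_def)
  show "Vector_Spaces.linear scale scale (\<lambda>w. D (mu w))"
    by (rule linear_comp[OF D linear_mu])
  fix k :: "'a monom \<times> 'a monom"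
  obtain a b where k: "Poly_Mapping.single k 1
      = tensor (Poly_Mapping.single a 1) (Poly_Mapping.single b 1)"
    by (cases k) simp
  interpret mu: Vector_Spaces.linear scale scale mu by (rule linear_mu)
  show "D (mu (Poly_Mapping.single k 1)) = mu (leibniz D (Poly_Mapping.single k 1))"
    unfolding k using assms
    by (simp add: leibniz_tensor[OF D] mu.add mu_tensor derivation_def del: tensor_single)
qed (rule linear_comp[OF linear_mu linear_leibniz])

lemma leibniz_Omega:
  assumes D: "Vector_Spaces.linear scale scale D"
    and comm: "\<And>v f. D (pdiff v f) = pdiff v (D f)"
  shows "leibniz D (Omega w) = Omega (leibniz D w)"
proof -
  interpret L: Vector_Spaces.linear scale scale "leibniz D" by (rule linear_leibniz)
  have step: "leibniz D (tensor_map (pdiff u) (pdiff v) w)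
      = tensor_map (pdiff u) (pdiff v) (leibniz D w)" for u v
  proof -
    interpret Q: Vector_Spaces.linear scale scale "tensor_map (pdiff u) (pdiff v)"
      by (rule linear_tensor_map)
    show ?thesis
      unfolding leibniz_def
      by (simp add: Q.add D comm linear_id_map linear_pdiff
          tensor_map_commute[where D' = "pdiff u" and E' = "pdiff v"])
  qed
  show ?thesis
    by (simp add: Omega_def dz_def dxi_def L.sum L.add step)
qed

lemma Lambda_commute:
  assumes D: "Vector_Spaces.linear scale scale D"
    and comm: "\<And>v f. D (pdiff v f) = pdiff v (D f)"
  shows "D (Lambda f) = Lambda (D f)"
proof -
  interpret D: Vector_Spaces.linear scale scale D by (rule D)
  show ?thesis by (simp add: Lambda_def dz_def dxi_def D.sum comm)
qed

section \<open>The deformed product and the isomorphism \<open>\<Phi>\<^sub>t\<close>\<close>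

text \<open>
  The Leibniz rule for the usual product is transported through \<open>exp (- t \<Omega>)\<close>. Commuting with all
  partial derivatives is what makes \<open>D \<otimes> 1 + 1 \<otimes> D\<close> commute with \<open>\<Omega>\<close>.
\<close>

lemma derivation_star:
  assumes D: "derivation (*) D"
    and comm: "\<And>v f. D (pdiff v f) = pdiff v (D f)"
  shows "derivation (star t) D"
proof -
  have lin: "Vector_Spaces.linear scale scale D" using D by (simp add: derivation_def)
  interpret mu: Vector_Spaces.linear scale scale mu by (rule linear_mu)
  have "D (star t f g) = star t (D f) g + star t f (D g)" for f g
  proof -
    let ?E = "exp_op (- t) Omega"
    have "D (star t f g) = mu (leibniz D (?E (tensor f g)))"
      by (simp add: star_def derivation_mu[OF D])
    also have "leibniz D (?E (tensor f g)) = ?E (leibniz D (tensor f g))"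
      by (rule linear_exp_op_commute[OF linear_leibniz leibniz_Omega[OF lin comm] finite_Omega_powers])
    also have "\<dots> = ?E (tensor (D f) g) + ?E (tensor f (D g))"
      by (simp only: leibniz_tensor[OF lin] exp_op_add[OF linear_Omega finite_Omega_powers finite_Omega_powers])
    finally show ?thesis by (simp add: mu.add star_def)
  qed
  with lin show ?thesis by (simp add: derivation_def)
qed

lemma Phi_commute:
  assumes "Vector_Spaces.linear scale scale D"
    and "\<And>v f. D (pdiff v f) = pdiff v (D f)"
  shows "D (Phi t f) = Phi t (D f)"
  unfolding Phi_def
  by (rule linear_exp_op_commute[OF assms(1) Lambda_commute[OF assms] finite_Lambda_powers])

lemma Phi_0: "Phi 0 = id"
  by (rule ext) (simp add: Phi_def exp_op_0)

lemma Phi_Phi: "Phi s (Phi t f) = Phi (s + t) f"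
  unfolding Phi_def by (rule exp_op_exp_op[OF linear_Lambda finite_Lambda_powers])

lemma inv_Phi: "inv (Phi t) = Phi (- t)"
  by (rule inv_unique_comp) (simp_all add: fun_eq_iff Phi_Phi Phi_0)

lemma Phi_push_fixed:
  assumes D: "derivation (*) D"
    and comm: "\<And>v f. D (pdiff v f) = pdiff v (D f)"
  shows "Phi_push t D = D"
proof -
  have lin: "Vector_Spaces.linear scale scale D" using D by (simp add: derivation_def)
  have "D \<in> weyl_algebra (star t)"
    by (rule weyl_algebra.deriv[OF derivation_star[OF D comm]])
  then have "Phi_push t D = Phi t \<circ> D \<circ> Phi (- t)"
    by (simp add: Phi_push_def inv_Phi)
  also have "\<dots> = D"
    by (rule ext) (simp add: Phi_commute[OF lin comm, symmetric] Phi_Phi Phi_0)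
  finally show ?thesis .
qed

theorem proposition2p11:
  fixes t :: complex
  shows "(\<forall>i :: 'n::finite. derivation (star t) (dz i) \<and> derivation (star t) (dxi i)) \<and>
         (\<forall>i :: 'n. Phi_push t (dz i) = dz i \<and> Phi_push t (dxi i) = dxi i)"
  by (simp add: dz_def dxi_def derivation_star[OF derivation_pdiff pdiff_commute]
      Phi_push_fixed[OF derivation_pdiff pdiff_commute])

end
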